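(* Let $q\ge 1$, let $f:\mathbb{R}^n\to\mathbb{R}^n$ be a $C^q$ function, and let $\mathbf{F}=(F_1,\dots,F_k):\mathbb{R}^n\to\mathbb{R}^k$, $k\le n$, be a $C^q$ vectorial conserved quantity of the differential equation $\dot x=f(x)$. For $r\in\{1,\dots,q\}$ let $$N^F_{(r)}=\{x\in\mathbb{R}^n \mid \partial^{\alpha}F_i(x)=0 \text{ for all } i\in\{1,\dots,k\},\ \text{all } l\in\{1,\dots,r\},\ \text{and all } \alpha\in\{1,\dots,n\}^l\}.$$ Then, for every $r\in\{1,\dots,q\}$, the set $N^F_{(r)}$ is invariant under the dynamics generated by $\dot x=f(x)$.
   Context: For $\alpha=(\alpha_1,\dots,\alpha_l)\in\{1,\dots,n\}^l$, $\partial^{\alpha}F_i=\frac{\partial^l F_i}{\partial x_{\alpha_1}\cdots\partial x_{\alpha_l}}$. Let $\Phi_t$ denote the flow of $\dot x=f(x)$, i.e. $t\mapsto\Phi_t(x)$ is the solution with $\Phi_0(x)=x$. $\mathbf{F}$ is a (vectorial) conserved quantity if $\mathbf{F}(\Phi_t(x))=\mathbf{F}(x)$ for all $x$ and all $t$ for which $\Phi_t(x)$ is defined. A set $N\subseteq\mathbb{R}^n$ is invariant under the dynamics if $x\in N$ implies $\Phi_t(x)\in N$ for all $t$ for which $\Phi_t(x)$ is defined. *)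

theory Defs
  imports "HOL-Analysis.Analysis"
begin

(* C^q on the whole space, coordinate-free: a map is C^(q+1) if it is Frechet differentiable
   everywhere and x |-> Df(x) v is C^q for every fixed direction v.  On a finite-dimensional
   space this says that Df, as a map into the space of linear maps, is C^q. *)
primrec Cq :: "nat \<Rightarrow> ('a::euclidean_space \<Rightarrow> 'b::real_normed_vector) \<Rightarrow> bool" where
  "Cq 0 g \<longleftrightarrow> continuous_on UNIV g"
| "Cq (Suc q) g \<longleftrightarrow>
     (\<forall>x. g differentiable (at x)) \<and> (\<forall>v. Cq q (\<lambda>x. frechet_derivative g (at x) v))"

definition partial_deriv :: "'n \<Rightarrow> (real^'n \<Rightarrow> real) \<Rightarrow> real^'n \<Rightarrow> real" where
  "partial_deriv j g x = deriv (\<lambda>t. g (x + t *\<^sub>R axis j 1)) 0"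

(* The multi-index (\<alpha>_1, ..., \<alpha>_l) is a list of coordinate indices, \<alpha>_1 outermost. *)
definition partial_derivs :: "'n list \<Rightarrow> (real^'n \<Rightarrow> real) \<Rightarrow> real^'n \<Rightarrow> real" where
  "partial_derivs \<alpha> g = foldr partial_deriv \<alpha> g"

definition solves_ivp ::
    "('a::real_normed_vector \<Rightarrow> 'a) \<Rightarrow> 'a \<Rightarrow> real set \<Rightarrow> (real \<Rightarrow> 'a) \<Rightarrow> bool" where
  "solves_ivp f x I u \<longleftrightarrow> open I \<and> is_interval I \<and> 0 \<in> I \<and> u 0 = x \<and>
     (\<forall>t\<in>I. (u has_vector_derivative f (u t)) (at t))"

(* The maximal interval of existence through x: the times t, positive or negative, for which
   the flow at x is defined. *)
definition flow_dom :: "('a::real_normed_vector \<Rightarrow> 'a) \<Rightarrow> 'a \<Rightarrow> real set" where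
  "flow_dom f x = \<Union>{I. \<exists>u. solves_ivp f x I u}"

(* THE is justified when solutions are unique, in particular when f is C^1; the value is
   meaningful only for t in flow_dom f x. *)
definition flow :: "('a::real_normed_vector \<Rightarrow> 'a) \<Rightarrow> real \<Rightarrow> 'a \<Rightarrow> 'a" where
  "flow f t x = (THE y. \<exists>I u. solves_ivp f x I u \<and> t \<in> I \<and> u t = y)"

definition conserved_quantity ::
    "('a::real_normed_vector \<Rightarrow> 'a) \<Rightarrow> ('a \<Rightarrow> 'b) \<Rightarrow> bool" where
  "conserved_quantity f F \<longleftrightarrow> (\<forall>x. \<forall>t\<in>flow_dom f x. F (flow f t x) = F x)"

definition invariant_set :: "('a::real_normed_vector \<Rightarrow> 'a) \<Rightarrow> 'a set \<Rightarrow> bool" where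
  "invariant_set f N \<longleftrightarrow> (\<forall>x\<in>N. \<forall>t\<in>flow_dom f x. flow f t x \<in> N)"

definition N_set :: "(real^'n \<Rightarrow> real^'k) \<Rightarrow> nat \<Rightarrow> (real^'n) set" where
  "N_set F r = {x. \<forall>i. \<forall>l\<in>{1..r}. \<forall>\<alpha>. length \<alpha> = l \<longrightarrow> partial_derivs \<alpha> (\<lambda>y. F y $ i) x = 0}"

end

theory Submission
  imports Defs
begin

text \<open>
For \<open>F\<close> of class \<open>C^r\<close>, a point \<open>x\<close> lies in \<open>N_set F r\<close> if and only if
\<open>F y - F x = o(dist y x ^ r)\<close> as \<open>y\<close> tends to \<open>x\<close>
(\<open>mem_N_set_iff_flat_at\<close>). One direction is Taylor's theorem (\<open>flat_at_if_partials_vanish\<close>); the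
other one reads off every mixed partial derivative from a finite difference
(\<open>partials_vanish_if_flat_at\<close>).

The growth condition refers to distances and to the values of \<open>F\<close> only. A locally Lipschitz
homeomorphism with locally Lipschitz inverse that preserves \<open>F\<close> therefore carries points where it
holds to points where it holds. The flow of a \<open>C^1\<close> vector field is of this kind: it is locally
Lipschitz by Gronwall's inequality (\<open>lipschitz_trajectories_dist\<close>), its inverse is the flow backward
in time, and it preserves \<open>F\<close> by hypothesis.

It suffices to move for short times. Around each point, solutions exist for a common time
(\<open>local_solutions_exist\<close>), so that along a trajectory membership in \<open>N_set F r\<close> is a locally constant
property of the time (\<open>solution_near_trajectory\<close>). The interval of existence is connected, and the
property holds at all times if it holds at time \<open>0\<close>. Uniqueness of solutions (\<open>solution_unique\<close>)
identifies the values of \<open>flow\<close> with the values of any given solution.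
\<close>

section \<open>Maps of class \<open>C^q\<close> and their iterated partial derivatives\<close>

lemma Cq_Suc_imp_Cq: "Cq (Suc q) g \<Longrightarrow> Cq q g"
proof (induction q arbitrary: g)
  case 0
  then show ?case
    by (auto intro!: continuous_at_imp_continuous_on differentiable_imp_continuous_within)
next
  case (Suc q)
  then show ?case by (metis Cq.simps(2))
qed

lemma Cq_mono:
  assumes "Cq q g" "r \<le> q"
  shows "Cq r g"
  using assms(2,1) by (induction rule: inc_induct) (auto dest: Cq_Suc_imp_Cq simp del: Cq.simps)

lemma Cq_vec_nth:
  fixes F :: "'a::euclidean_space \<Rightarrow> real^'k"
  shows "Cq q F \<Longrightarrow> Cq q (\<lambda>x. F x $ i)"
proof (induction q arbitrary: F)
  case 0
  then show ?case by (auto intro: continuous_intros)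
next
  case (Suc q)
  have D: "((\<lambda>x. F x $ i) has_derivative (\<lambda>v. frechet_derivative F (at x) v $ i)) (at x)" for x
    using Suc.prems
    by (intro bounded_linear.has_derivative[OF bounded_linear_vec_nth])
      (simp add: frechet_derivative_works)
  have "frechet_derivative (\<lambda>x. F x $ i) (at x) = (\<lambda>v. frechet_derivative F (at x) v $ i)" for x
    using frechet_derivative_at[OF D] by simp
  with D Suc show ?case by (auto simp: differentiable_def)
qed

lemma has_real_derivative_along_line:
  fixes g :: "'a::real_normed_vector \<Rightarrow> real"
  assumes "g differentiable at (x + s *\<^sub>R v)"
  shows "((\<lambda>s. g (x + s *\<^sub>R v)) has_real_derivative
           frechet_derivative g (at (x + s *\<^sub>R v)) v) (at s)"
proof -
  let ?D = "frechet_derivative g (at (x + s *\<^sub>R v))"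
  have g: "(g has_derivative ?D) (at (x + s *\<^sub>R v))"
    using assms by (simp add: frechet_derivative_works)
  have "((\<lambda>s. x + s *\<^sub>R v) has_derivative (\<lambda>h. h *\<^sub>R v)) (at s)"
    by (auto intro!: derivative_eq_intros)
  from has_derivative_compose[OF this g]
  have "((\<lambda>s. g (x + s *\<^sub>R v)) has_derivative (\<lambda>h. ?D (h *\<^sub>R v))) (at s)" .
  moreover have "(\<lambda>h. ?D (h *\<^sub>R v)) = (*) (?D v)"
    using linear_frechet_derivative[OF assms] by (simp add: fun_eq_iff linear_cmul)
  ultimately show ?thesis unfolding has_field_derivative_def by simp
qed

lemma partial_deriv_eq_frechet_derivative:
  assumes "g differentiable at x"
  shows "partial_deriv j g x = frechet_derivative g (at x) (axis j 1)"
  using has_real_derivative_along_line[of g x 0 "axis j 1"] assms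
  by (auto simp: partial_deriv_def intro: DERIV_imp_deriv)

lemma Cq_partial_deriv:
  assumes "Cq (Suc q) g"
  shows "Cq q (partial_deriv j g)"
proof -
  have "partial_deriv j g = (\<lambda>x. frechet_derivative g (at x) (axis j 1))"
    using assms by (auto simp: partial_deriv_eq_frechet_derivative)
  with assms show ?thesis by simp
qed

lemma partial_derivs_snoc: "partial_derivs (\<alpha> @ [j]) g = partial_derivs \<alpha> (partial_deriv j g)"
  by (simp add: partial_derivs_def)

lemma continuous_partial_derivs:
  "Cq (length \<alpha>) g \<Longrightarrow> continuous_on UNIV (partial_derivs \<alpha> g)"
proof (induction \<alpha> arbitrary: g rule: rev_induct)
  case Nil
  then show ?case by (simp add: partial_derivs_def)
next
  case (snoc j \<alpha>)
  then show ?case by (simp add: partial_derivs_snoc Cq_partial_deriv del: Cq.simps)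
qed

lemma norm_frechet_derivative_le_partials:
  fixes g :: "real^'n \<Rightarrow> real"
  assumes "g differentiable at x"
  shows "norm (frechet_derivative g (at x) v) \<le> (\<Sum>j\<in>UNIV. \<bar>partial_deriv j g x\<bar>) * norm v"
proof -
  let ?D = "frechet_derivative g (at x)"
  have lin: "linear ?D" using assms by (rule linear_frechet_derivative)
  have "?D v = ?D (\<Sum>j\<in>UNIV. v $ j *\<^sub>R axis j 1)"
    by (metis basis_expansion scalar_mult_eq_scaleR)
  also have "\<dots> = (\<Sum>j\<in>UNIV. v $ j * partial_deriv j g x)"
    using assms
    by (simp add: linear_sum[OF lin] linear_cmul[OF lin] partial_deriv_eq_frechet_derivative)
  also have "norm \<dots> \<le> (\<Sum>j\<in>UNIV. \<bar>partial_deriv j g x\<bar> * norm v)"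
    by (intro sum_norm_le) (simp add: abs_mult component_le_norm_cart mult.commute mult_right_mono)
  finally show ?thesis by (simp add: sum_distrib_right)
qed

section \<open>Vanishing of the derivatives as a growth condition\<close>

text \<open>
Flatness of order \<open>r\<close> is the condition \<open>g y - g x = o(dist y x ^ r)\<close>. It mentions distances and values
only, so that every bi-Lipschitz change of variables that preserves \<open>g\<close> carries it along.
\<close>

definition flat_at :: "nat \<Rightarrow> ('a::metric_space \<Rightarrow> 'b::metric_space) \<Rightarrow> 'a \<Rightarrow> bool" where
  "flat_at r g x \<longleftrightarrow> (\<forall>e>0. \<exists>d>0. \<forall>y. dist y x < d \<longrightarrow> dist (g y) (g x) \<le> e * dist y x ^ r)"

text \<open>
A weak form of Taylor's theorem, by induction on \<open>r\<close>: the first partial derivatives are flat one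
order lower by the induction hypothesis, and they vanish at \<open>x\<close>, so the derivative of \<open>g\<close> is
\<open>o(dist y x ^ r)\<close>. The mean value inequality on the ball around \<open>x\<close> through \<open>y\<close> gains the missing
factor \<open>dist y x\<close>.
\<close>

lemma flat_at_if_partials_vanish:
  fixes g :: "real^'n \<Rightarrow> real"
  assumes "Cq r g" "\<And>\<alpha>. 1 \<le> length \<alpha> \<Longrightarrow> length \<alpha> \<le> r \<Longrightarrow> partial_derivs \<alpha> g x = 0"
  shows "flat_at r g x"
  using assms
proof (induction r arbitrary: g)
  case 0
  then have "isCont g x" by (simp add: continuous_on_eq_continuous_at)
  then show ?case unfolding flat_at_def continuous_at_eps_delta
    by (metis less_eq_real_def mult.right_neutral power_0)
next
  case (Suc r)
  have diff: "g differentiable at y" for y using Suc.prems(1) by simp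
  have zero: "partial_deriv j g x = 0" for j
    using Suc.prems(2)[of "[j]"] by (simp add: partial_derivs_def)
  have flat: "flat_at r (partial_deriv j g) x" for j
  proof (rule Suc.IH)
    show "Cq r (partial_deriv j g)" using Suc.prems(1) by (rule Cq_partial_deriv)
    show "partial_derivs \<alpha> (partial_deriv j g) x = 0"
      if "1 \<le> length \<alpha>" "length \<alpha> \<le> r" for \<alpha>
      using that Suc.prems(2)[of "\<alpha> @ [j]"] by (simp add: partial_derivs_snoc)
  qed
  show ?case unfolding flat_at_def
  proof (intro allI impI)
    fix e :: real assume "e > 0"
    define e' where "e' = e / CARD('n)"
    have "e' > 0" using \<open>e > 0\<close> by (simp add: e'_def)
    with flat zero have "\<forall>j. \<exists>d>0. \<forall>y. dist y x < d \<longrightarrow> \<bar>partial_deriv j g y\<bar> \<le> e' * dist y x ^ r"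
      unfolding flat_at_def by (simp add: dist_real_def)
    then obtain d where d: "\<And>j. d j > 0"
      "\<And>j y. dist y x < d j \<Longrightarrow> \<bar>partial_deriv j g y\<bar> \<le> e' * dist y x ^ r"
      by metis
    have "dist (g y) (g x) \<le> e * dist y x ^ Suc r" if y: "dist y x < Min (range d)" for y
    proof -
      have B: "onorm (frechet_derivative g (at z)) \<le> e * dist y x ^ r" if z: "z \<in> cball x (dist y x)" for z
      proof (rule onorm_le)
        fix v
        have le: "dist z x \<le> dist y x" using z by (simp add: dist_commute)
        have "\<bar>partial_deriv j g z\<bar> \<le> e' * dist y x ^ r" for j
        proof -
          have "Min (range d) \<le> d j" by simp
          then have "\<bar>partial_deriv j g z\<bar> \<le> e' * dist z x ^ r" using le y by (intro d(2)) linarith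
          also have "\<dots> \<le> e' * dist y x ^ r" using le \<open>e' > 0\<close> by (simp add: power_mono)
          finally show ?thesis .
        qed
        then have "(\<Sum>j\<in>UNIV. \<bar>partial_deriv j g z\<bar>) \<le> CARD('n) * (e' * dist y x ^ r)"
          by (intro sum_bounded_above) auto
        also have "\<dots> = e * dist y x ^ r" by (simp add: e'_def)
        finally show "norm (frechet_derivative g (at z) v) \<le> e * dist y x ^ r * norm v"
          using norm_frechet_derivative_le_partials[OF diff, of z v] by (meson mult_right_mono norm_ge_zero order_trans)
      qed
      have "norm (g y - g x) \<le> e * dist y x ^ r * norm (y - x)"
      proof (rule differentiable_bound[OF convex_cball _ B])
        show "(g has_derivative frechet_derivative g (at z)) (at z within cball x (dist y x))" for z
          using diff[of z] by (simp add: frechet_derivative_works has_derivative_at_withinI)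
      qed (auto simp: dist_commute)
      then show ?thesis by (simp add: dist_norm mult_ac)
    qed
    moreover have "Min (range d) > 0" using d(1) by auto
    ultimately show "\<exists>d>0. \<forall>y. dist y x < d \<longrightarrow> dist (g y) (g x) \<le> e * dist y x ^ Suc r" by blast
  qed
qed

text \<open>
The converse compares the partial derivative \<open>\<partial>\<^sup>\<alpha> g\<close> with an iterated finite difference
of \<open>g\<close> of step \<open>t\<close> in the coordinate directions listed by \<open>\<alpha>\<close>. The difference is a signed
sum of values of \<open>g\<close>, hence small when \<open>g\<close> is flat; and it equals \<open>t ^ length \<alpha>\<close> times a value
of \<open>\<partial>\<^sup>\<alpha> g\<close> near \<open>x\<close>.
\<close>

primrec iter_diff :: "real \<Rightarrow> 'n list \<Rightarrow> (real^'n \<Rightarrow> real) \<Rightarrow> real^'n \<Rightarrow> real" where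
  "iter_diff t [] g x = g x"
| "iter_diff t (a # \<beta>) g x = iter_diff t \<beta> g (x + t *\<^sub>R axis a 1) - iter_diff t \<beta> g x"

text \<open>
Differencing is linear and commutes with translations, hence with differentiation.
\<close>

lemma iter_diff_has_real_derivative:
  assumes "\<And>y. g differentiable at y"
  shows "((\<lambda>s. iter_diff t \<beta> g (x + s *\<^sub>R axis a 1)) has_real_derivative
           iter_diff t \<beta> (partial_deriv a g) (x + s *\<^sub>R axis a 1)) (at s)"
proof (induction \<beta> arbitrary: x)
  case Nil
  then show ?case
    using has_real_derivative_along_line[OF assms]
    by (simp add: partial_deriv_eq_frechet_derivative assms)
next
  case (Cons b \<beta>)
  show ?case
    using DERIV_diff[OF Cons[of "x + t *\<^sub>R axis b 1"] Cons[of x]] by (simp add: add_ac)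
qed

text \<open>
Each differencing step is one application of the one-dimensional mean value theorem, which turns
the outermost difference into \<open>t\<close> times a partial derivative acting directly on \<open>g\<close>. The outermost
difference thus becomes the innermost derivative, whence \<open>rev\<close>.
\<close>

lemma iter_diff_mean_value:
  fixes t :: real
  assumes "t > 0" "Cq (length \<beta>) g"
  shows "\<exists>\<xi>. dist \<xi> x \<le> t * length \<beta> \<and>
              iter_diff t \<beta> g x = t ^ length \<beta> * partial_derivs (rev \<beta>) g \<xi>"
  using assms(2)
proof (induction \<beta> arbitrary: g x)
  case Nil
  then show ?case by (intro exI[of _ x]) (simp add: partial_derivs_def)
next
  case (Cons a \<beta>)
  have "\<And>y. g differentiable at y" using Cons.prems by simp
  from MVT2[OF \<open>t > 0\<close> iter_diff_has_real_derivative[OF this, of t \<beta> x a]]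
  obtain z where z: "0 < z" "z < t"
    and eq: "iter_diff t (a # \<beta>) g x = t * iter_diff t \<beta> (partial_deriv a g) (x + z *\<^sub>R axis a 1)"
    by auto
  have "Cq (length \<beta>) (partial_deriv a g)" using Cons.prems by (intro Cq_partial_deriv) simp
  from Cons.IH[OF this, of "x + z *\<^sub>R axis a 1"]
  obtain \<xi> where \<xi>: "dist \<xi> (x + z *\<^sub>R axis a 1) \<le> t * length \<beta>"
    "iter_diff t \<beta> (partial_deriv a g) (x + z *\<^sub>R axis a 1)
       = t ^ length \<beta> * partial_derivs (rev \<beta>) (partial_deriv a g) \<xi>"
    by blast
  have "dist \<xi> x \<le> dist \<xi> (x + z *\<^sub>R axis a 1) + dist (x + z *\<^sub>R axis a 1) x"
    by (rule dist_triangle)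
  also have "dist (x + z *\<^sub>R axis a 1) x = z" using z by (simp add: dist_norm)
  finally have "dist \<xi> x \<le> t * length (a # \<beta>)" using \<xi>(1) z by (simp add: algebra_simps)
  with eq \<xi>(2) show ?case by (intro exI[of _ \<xi>]) (simp add: partial_derivs_snoc)
qed

text \<open>
The difference of order \<open>l\<close> is a sum of \<open>2 ^ l\<close> signed values of \<open>g\<close>. For \<open>l \<ge> 1\<close> the
signs cancel a constant \<open>c\<close>; for \<open>l = 0\<close> there is nothing to cancel it, which the conditional
corrects, so that the bound can be proved by induction on \<open>\<beta>\<close>.
\<close>

lemma abs_iter_diff_le:
  fixes t :: real
  assumes "t \<ge> 0" "\<And>y. dist y x \<le> t * length \<beta> \<Longrightarrow> \<bar>g y - c\<bar> \<le> e"
  shows "\<bar>iter_diff t \<beta> g x - (if \<beta> = [] then c else 0)\<bar> \<le> 2 ^ length \<beta> * e"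
  using assms(2)
proof (induction \<beta> arbitrary: x)
  case Nil
  then show ?case by simp
next
  case (Cons a \<beta>)
  have 1: "\<bar>iter_diff t \<beta> g x - (if \<beta> = [] then c else 0)\<bar> \<le> 2 ^ length \<beta> * e"
  proof (rule Cons.IH)
    fix y assume "dist y x \<le> t * length \<beta>"
    then show "\<bar>g y - c\<bar> \<le> e" using assms(1) by (intro Cons.prems) (simp add: algebra_simps)
  qed
  have 2: "\<bar>iter_diff t \<beta> g (x + t *\<^sub>R axis a 1) - (if \<beta> = [] then c else 0)\<bar> \<le> 2 ^ length \<beta> * e"
  proof (rule Cons.IH)
    fix y assume y: "dist y (x + t *\<^sub>R axis a 1) \<le> t * length \<beta>"
    have "dist y x \<le> dist y (x + t *\<^sub>R axis a 1) + dist (x + t *\<^sub>R axis a 1) x"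
      by (rule dist_triangle)
    also have "dist (x + t *\<^sub>R axis a 1) x = t" using assms(1) by (simp add: dist_norm)
    finally show "\<bar>g y - c\<bar> \<le> e" using y by (intro Cons.prems) (simp add: algebra_simps)
  qed
  from 1 2 show ?case by (auto simp: algebra_simps)
qed

text \<open>
If the partial derivative \<open>\<partial>\<^sup>\<alpha> g\<close> of order \<open>l\<close> were not zero at \<open>x\<close>, then by continuity the
difference along \<open>\<alpha>\<close> would be at least a constant multiple of \<open>t ^ l\<close> for small \<open>t\<close>, whereas flatness makes
it \<open>o(t ^ r)\<close>, and \<open>l \<le> r\<close>.
\<close>

lemma partials_vanish_if_flat_at:
  fixes g :: "real^'n \<Rightarrow> real"
  assumes "Cq r g" "flat_at r g x" "1 \<le> length \<alpha>" "length \<alpha> \<le> r"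
  shows "partial_derivs \<alpha> g x = 0"
proof (rule ccontr)
  let ?l = "length \<alpha>"
  let ?P = "partial_derivs \<alpha> g"
  assume "?P x \<noteq> 0"
  define c where "c = \<bar>?P x\<bar>"
  have "c > 0" using \<open>?P x \<noteq> 0\<close> by (simp add: c_def)
  have l: "real ?l > 0" using assms(3) by (cases \<alpha>) auto
  have Cl: "Cq ?l g" using assms(1,4) by (rule Cq_mono)
  have "isCont ?P x"
    using continuous_partial_derivs[OF Cl] by (simp add: continuous_on_eq_continuous_at)
  then obtain d1 where d1: "d1 > 0" "\<And>y. dist y x < d1 \<Longrightarrow> dist (?P y) (?P x) < c / 2"
    unfolding continuous_at_eps_delta using \<open>c > 0\<close> half_gt_zero by metis
  \<comment> \<open>With this \<open>e\<close>, the bound \<open>2 ^ l * (e * (t * l) ^ r)\<close> for the difference is \<open>t ^ r * (c / 2)\<close>.\<close>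
  define e where "e = c / (2 * 2 ^ ?l * real ?l ^ r)"
  have "e > 0" using \<open>c > 0\<close> l by (simp add: e_def)
  then obtain d2 where d2: "d2 > 0" "\<And>y. dist y x < d2 \<Longrightarrow> dist (g y) (g x) \<le> e * dist y x ^ r"
    using assms(2) unfolding flat_at_def by blast
  define t where "t = min 1 (min d1 d2 / (2 * ?l))"
  have t: "t > 0" "t \<le> 1" using d1(1) d2(1) l by (auto simp: t_def)
  have "t \<le> min d1 d2 / (2 * ?l)" by (simp add: t_def)
  then have "t * ?l \<le> min d1 d2 / 2" using l by (simp add: field_simps)
  then have tl: "t * ?l < d1" "t * ?l < d2" using d1(1) d2(1) by linarith+
  obtain \<xi> where \<xi>: "dist \<xi> x \<le> t * ?l" "iter_diff t (rev \<alpha>) g x = t ^ ?l * ?P \<xi>"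
    using iter_diff_mean_value[of t "rev \<alpha>" g x] t(1) Cl by auto
  have "\<bar>iter_diff t (rev \<alpha>) g x - (if rev \<alpha> = [] then g x else 0)\<bar>
      \<le> 2 ^ length (rev \<alpha>) * (e * (t * ?l) ^ r)"
  proof (rule abs_iter_diff_le)
    fix y assume y: "dist y x \<le> t * length (rev \<alpha>)"
    then have "\<bar>g y - g x\<bar> \<le> e * dist y x ^ r" using d2(2)[of y] tl(2) by (simp add: dist_real_def)
    also have "\<dots> \<le> e * (t * ?l) ^ r" using y \<open>e > 0\<close> by (simp add: power_mono)
    finally show "\<bar>g y - g x\<bar> \<le> e * (t * ?l) ^ r" .
  qed (use t in auto)
  moreover have "rev \<alpha> \<noteq> []" using assms(3) by auto
  ultimately have "\<bar>t ^ ?l * ?P \<xi>\<bar> \<le> 2 ^ ?l * (e * (t * ?l) ^ r)" using \<xi>(2) by simp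
  also have "\<dots> = t ^ r * (c / 2)" using l by (simp add: e_def power_mult_distrib field_simps)
  also have "\<dots> \<le> t ^ ?l * (c / 2)"
    using t \<open>c > 0\<close> assms(4) by (intro mult_right_mono power_decreasing) auto
  finally have "\<bar>?P \<xi>\<bar> \<le> c / 2" using t(1) by (simp add: abs_mult)
  moreover have "\<bar>?P \<xi> - ?P x\<bar> < c / 2" using d1(2)[of \<xi>] \<xi>(1) tl(1) by (simp add: dist_real_def)
  moreover have "\<bar>?P x\<bar> \<le> \<bar>?P \<xi>\<bar> + \<bar>?P \<xi> - ?P x\<bar>" by linarith
  ultimately show False unfolding c_def by linarith
qed

text \<open>
Flatness is inherited from \<open>x\<close> by \<open>x'\<close> if every value that \<open>g\<close> takes near \<open>x'\<close> is also taken near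
\<open>x\<close>, at a point whose distance to \<open>x\<close> is larger by at most a constant factor. Along a flow, the
companion \<open>z\<close> of \<open>y\<close> is the point that lies on the same trajectory as \<open>y\<close>.
\<close>

lemma flat_at_transport:
  assumes "flat_at r g x" "g x' = g x" "d > 0"
    and "\<And>y. dist y x' < d \<Longrightarrow> \<exists>z. dist z x \<le> C * dist y x' \<and> g z = g y"
  shows "flat_at r g x'"
  unfolding flat_at_def
proof (intro allI impI)
  fix e :: real assume "e > 0"
  define C' where "C' = max C 1"
  have C': "C' > 0" by (simp add: C'_def)
  then have "e / C' ^ r > 0" using \<open>e > 0\<close> by simp
  then obtain d1 where d1: "d1 > 0" "\<And>z. dist z x < d1 \<Longrightarrow> dist (g z) (g x) \<le> e / C' ^ r * dist z x ^ r"
    using assms(1) unfolding flat_at_def by blast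
  have "dist (g y) (g x') \<le> e * dist y x' ^ r" if y: "dist y x' < min d (d1 / C')" for y
  proof -
    obtain z where z: "dist z x \<le> C * dist y x'" "g z = g y" using assms(4)[of y] y by auto
    have "C * dist y x' \<le> C' * dist y x'" by (simp add: C'_def mult_right_mono)
    with z have z': "dist z x \<le> C' * dist y x'" by simp
    also have "\<dots> < d1" using y C' by (simp add: field_simps)
    finally have "dist (g z) (g x) \<le> e / C' ^ r * dist z x ^ r" by (rule d1)
    also have "\<dots> \<le> e / C' ^ r * (C' * dist y x') ^ r"
      using z' \<open>e > 0\<close> C' by (intro mult_left_mono power_mono) auto
    also have "\<dots> = e * dist y x' ^ r" using C' by (simp add: power_mult_distrib)
    finally show ?thesis using z assms(2) by simp
  qed
  moreover have "min d (d1 / C') > 0" using assms(3) d1(1) C' by simp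
  ultimately show "\<exists>d>0. \<forall>y. dist y x' < d \<longrightarrow> dist (g y) (g x') \<le> e * dist y x' ^ r" by blast
qed

lemma mem_N_set_iff_flat_at:
  assumes "Cq r F"
  shows "x \<in> N_set F r \<longleftrightarrow> (\<forall>i. flat_at r (\<lambda>y. F y $ i) x)"
proof -
  have C: "Cq r (\<lambda>y. F y $ i)" for i using assms by (rule Cq_vec_nth)
  show ?thesis
    using flat_at_if_partials_vanish[OF C] partials_vanish_if_flat_at[OF C]
    by (auto simp: N_set_def)
qed

section \<open>Trajectories of a \<open>C^1\<close> vector field\<close>

lemma C1_lipschitz_on_cball:
  fixes f :: "'a::euclidean_space \<Rightarrow> 'b::real_normed_vector"
  assumes "Cq 1 f"
  obtains K where "K \<ge> 0" "\<And>x y. x \<in> cball p R \<Longrightarrow> y \<in> cball p R \<Longrightarrow> dist (f x) (f y) \<le> K * dist x y"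
proof -
  let ?D = "\<lambda>x. frechet_derivative f (at x)"
  have diff: "f differentiable at x" for x using assms by simp
  have "\<exists>B\<ge>0. \<forall>x\<in>cball p R. norm (?D x b) \<le> B" for b
  proof -
    have "continuous_on (cball p R) (\<lambda>x. ?D x b)"
      using assms by (auto intro: continuous_on_subset)
    then have "bounded ((\<lambda>x. ?D x b) ` cball p R)"
      by (intro compact_imp_bounded compact_continuous_image) auto
    then show ?thesis unfolding bounded_pos by (metis imageI less_imp_le)
  qed
  then obtain B where B: "\<And>b. B b \<ge> 0" "\<And>b x. x \<in> cball p R \<Longrightarrow> norm (?D x b) \<le> B b"
    by metis
  define K where "K = (\<Sum>b\<in>Basis. B b)"
  have on: "onorm (?D x) \<le> K" if x: "x \<in> cball p R" for x
  proof (rule onorm_le)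
    fix v
    have lin: "linear (?D x)" using diff by (rule linear_frechet_derivative)
    have "?D x v = ?D x (\<Sum>b\<in>Basis. (v \<bullet> b) *\<^sub>R b)" by (simp add: euclidean_representation)
    also have "\<dots> = (\<Sum>b\<in>Basis. (v \<bullet> b) *\<^sub>R ?D x b)"
      by (simp add: linear_sum[OF lin] linear_cmul[OF lin])
    also have "norm \<dots> \<le> (\<Sum>b\<in>Basis. B b * norm v)"
    proof (rule sum_norm_le)
      fix b :: 'a assume "b \<in> Basis"
      have "norm ((v \<bullet> b) *\<^sub>R ?D x b) = norm (?D x b) * \<bar>v \<bullet> b\<bar>" by simp
      also have "\<dots> \<le> B b * norm v"
        using B x Basis_le_norm[OF \<open>b \<in> Basis\<close>] by (intro mult_mono) auto
      finally show "norm ((v \<bullet> b) *\<^sub>R ?D x b) \<le> B b * norm v" .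
    qed
    finally show "norm (?D x v) \<le> K * norm v" by (simp add: K_def sum_distrib_right)
  qed
  show thesis
  proof
    show "K \<ge> 0" using B(1) by (simp add: K_def sum_nonneg)
    show "dist (f x) (f y) \<le> K * dist x y" if "x \<in> cball p R" "y \<in> cball p R" for x y
      unfolding dist_norm
    proof (rule differentiable_bound[OF convex_cball _ on that])
      show "(f has_derivative ?D z) (at z within cball p R)" for z
        using diff[of z] by (simp add: frechet_derivative_works has_derivative_at_withinI)
    qed
  qed
qed

text \<open>
A version of Gronwall's inequality. For two trajectories \<open>u\<close> and \<open>v\<close>, the squared distance
\<open>\<phi>\<close> satisfies \<open>\<bar>\<phi>'\<bar> \<le> 2 * K * \<phi>\<close>, so \<open>\<phi> \<tau> * exp (- 2 * K * \<tau>)\<close> decreases and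
\<open>\<phi> \<tau> * exp (2 * K * \<tau>)\<close> increases. The square is differentiable even where the
trajectories meet. The times \<open>s\<close> and \<open>t\<close> may come in either order, since flatness has to be
transported backward as well as forward in time.
\<close>

lemma lipschitz_trajectories_dist:
  fixes f :: "'a::real_inner \<Rightarrow> 'a" and u v :: "real \<Rightarrow> 'a"
  assumes lip: "\<And>x y. x \<in> S \<Longrightarrow> y \<in> S \<Longrightarrow> dist (f x) (f y) \<le> K * dist x y"
    and u: "\<And>\<tau>. \<tau> \<in> closed_segment s t \<Longrightarrow> (u has_vector_derivative f (u \<tau>)) (at \<tau>) \<and> u \<tau> \<in> S"
    and v: "\<And>\<tau>. \<tau> \<in> closed_segment s t \<Longrightarrow> (v has_vector_derivative f (v \<tau>)) (at \<tau>) \<and> v \<tau> \<in> S"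
  shows "dist (u s) (v s) \<le> exp (K * \<bar>s - t\<bar>) * dist (u t) (v t)"
proof -
  define \<phi> where "\<phi> \<tau> = (norm (u \<tau> - v \<tau>))\<^sup>2" for \<tau>
  define \<phi>' where "\<phi>' \<tau> = 2 * ((u \<tau> - v \<tau>) \<bullet> (f (u \<tau>) - f (v \<tau>)))" for \<tau>
  have D: "(\<phi> has_real_derivative \<phi>' \<tau>) (at \<tau>)" and bound: "\<bar>\<phi>' \<tau>\<bar> \<le> 2 * K * \<phi> \<tau>"
    if \<tau>: "\<tau> \<in> closed_segment s t" for \<tau>
  proof -
    have w: "((\<lambda>\<tau>. u \<tau> - v \<tau>) has_vector_derivative (f (u \<tau>) - f (v \<tau>))) (at \<tau>)"
      using u[OF \<tau>] v[OF \<tau>] by (auto intro: has_vector_derivative_diff)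
    have "((\<lambda>\<tau>. (u \<tau> - v \<tau>) \<bullet> (u \<tau> - v \<tau>)) has_derivative
        (\<lambda>h. (u \<tau> - v \<tau>) \<bullet> (h *\<^sub>R (f (u \<tau>) - f (v \<tau>))) + (h *\<^sub>R (f (u \<tau>) - f (v \<tau>))) \<bullet> (u \<tau> - v \<tau>))) (at \<tau>)"
      using w by (intro has_derivative_inner) (simp_all add: has_vector_derivative_def)
    then show "(\<phi> has_real_derivative \<phi>' \<tau>) (at \<tau>)"
      unfolding has_field_derivative_def \<phi>_def \<phi>'_def power2_norm_eq_inner
      by (rule back_subst[where P = "\<lambda>D. (_ has_derivative D) _"])
        (auto simp: inner_commute algebra_simps)
    have "\<bar>\<phi>' \<tau>\<bar> \<le> 2 * (norm (u \<tau> - v \<tau>) * norm (f (u \<tau>) - f (v \<tau>)))"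
      unfolding \<phi>'_def using Cauchy_Schwarz_ineq2[of "u \<tau> - v \<tau>" "f (u \<tau>) - f (v \<tau>)"] by simp
    also have "\<dots> \<le> 2 * (norm (u \<tau> - v \<tau>) * (K * norm (u \<tau> - v \<tau>)))"
      using lip[of "u \<tau>" "v \<tau>"] u[OF \<tau>] v[OF \<tau>] by (intro mult_left_mono) (auto simp: dist_norm)
    also have "\<dots> = 2 * K * \<phi> \<tau>" by (simp add: \<phi>_def power2_eq_square)
    finally show "\<bar>\<phi>' \<tau>\<bar> \<le> 2 * K * \<phi> \<tau>" .
  qed
  have "\<phi> s \<le> exp (2 * K * \<bar>s - t\<bar>) * \<phi> t"
  proof (cases "t \<le> s")
    case True
    have "\<phi> s * exp (- (2 * K * s)) \<le> \<phi> t * exp (- (2 * K * t))"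
    proof (rule DERIV_nonpos_imp_nonincreasing[OF True])
      fix \<tau> assume "t \<le> \<tau>" "\<tau> \<le> s"
      then have \<tau>: "\<tau> \<in> closed_segment s t" by (simp add: closed_segment_eq_real_ivl)
      have "((\<lambda>\<tau>. \<phi> \<tau> * exp (- (2 * K * \<tau>))) has_real_derivative
          (\<phi>' \<tau> - 2 * K * \<phi> \<tau>) * exp (- (2 * K * \<tau>))) (at \<tau>)"
        using D[OF \<tau>] by (auto intro!: derivative_eq_intros simp: algebra_simps)
      moreover have "(\<phi>' \<tau> - 2 * K * \<phi> \<tau>) * exp (- (2 * K * \<tau>)) \<le> 0"
        using bound[OF \<tau>] by (simp add: mult_le_0_iff)
      ultimately show "\<exists>y. ((\<lambda>\<tau>. \<phi> \<tau> * exp (- (2 * K * \<tau>))) has_real_derivative y) (at \<tau>) \<and> y \<le> 0"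
        by blast
    qed
    then have "\<phi> s * exp (- (2 * K * s)) * exp (2 * K * s) \<le> \<phi> t * exp (- (2 * K * t)) * exp (2 * K * s)"
      by (intro mult_right_mono) auto
    then show ?thesis using True by (simp add: mult.assoc exp_add[symmetric] algebra_simps)
  next
    case False
    then have le: "s \<le> t" by simp
    have "\<phi> s * exp (2 * K * s) \<le> \<phi> t * exp (2 * K * t)"
    proof (rule DERIV_nonneg_imp_nondecreasing[OF le])
      fix \<tau> assume "s \<le> \<tau>" "\<tau> \<le> t"
      then have \<tau>: "\<tau> \<in> closed_segment s t" by (simp add: closed_segment_eq_real_ivl)
      have "((\<lambda>\<tau>. \<phi> \<tau> * exp (2 * K * \<tau>)) has_real_derivative
          (\<phi>' \<tau> + 2 * K * \<phi> \<tau>) * exp (2 * K * \<tau>)) (at \<tau>)"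
        using D[OF \<tau>] by (auto intro!: derivative_eq_intros simp: algebra_simps)
      moreover have "(\<phi>' \<tau> + 2 * K * \<phi> \<tau>) * exp (2 * K * \<tau>) \<ge> 0"
        using bound[OF \<tau>] by simp
      ultimately show "\<exists>y. ((\<lambda>\<tau>. \<phi> \<tau> * exp (2 * K * \<tau>)) has_real_derivative y) (at \<tau>) \<and> y \<ge> 0"
        by blast
    qed
    then have "\<phi> s * exp (2 * K * s) * exp (- (2 * K * s)) \<le> \<phi> t * exp (2 * K * t) * exp (- (2 * K * s))"
      by (intro mult_right_mono) auto
    then show ?thesis using le by (simp add: mult.assoc exp_add[symmetric] algebra_simps)
  qed
  also have "exp (2 * K * \<bar>s - t\<bar>) * \<phi> t = (exp (K * \<bar>s - t\<bar>) * norm (u t - v t))\<^sup>2"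
    by (simp add: \<phi>_def power_mult_distrib exp_double[symmetric] mult.assoc)
  finally show ?thesis
    unfolding \<phi>_def dist_norm by (rule power2_le_imp_le) simp
qed

text \<open>
Coincidence of two solutions is a locally constant property of the time: where they agree, they
agree nearby by the Lipschitz estimate, and where they differ, they differ nearby by continuity.
\<close>

lemma solution_unique:
  fixes f :: "'a::euclidean_space \<Rightarrow> 'a"
  assumes "Cq 1 f" and u: "solves_ivp f x I u" and v: "solves_ivp f x J v"
    and "t \<in> I" "t \<in> J"
  shows "u t = v t"
proof -
  let ?A = "I \<inter> J"
  have "is_interval ?A" "open ?A" "0 \<in> ?A"
    using u v by (auto simp: solves_ivp_def intro: is_interval_Int)
  have cu: "isCont u s" and cv: "isCont v s" if "s \<in> ?A" for s
    using u v that by (auto simp: solves_ivp_def intro: has_vector_derivative_continuous)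
  have "(u 0 = v 0) = (u t = v t)"
  proof (rule connected_local_const[of ?A])
    show "connected ?A" using \<open>is_interval ?A\<close> by (rule is_interval_connected)
    show "\<forall>s\<in>?A. eventually (\<lambda>t. (u s = v s) = (u t = v t)) (at s within ?A)"
    proof
      fix s assume s: "s \<in> ?A"
      show "eventually (\<lambda>t. (u s = v s) = (u t = v t)) (at s within ?A)"
      proof (cases "u s = v s")
        case True
        obtain K where K: "\<And>x y. x \<in> cball (u s) 1 \<Longrightarrow> y \<in> cball (u s) 1 \<Longrightarrow> dist (f x) (f y) \<le> K * dist x y"
          using C1_lipschitz_on_cball[OF assms(1)] by metis
        obtain d1 where d1: "d1 > 0" "\<And>\<tau>. dist \<tau> s < d1 \<Longrightarrow> dist (u \<tau>) (u s) < 1"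
          using cu[OF s] unfolding continuous_at_eps_delta by (metis zero_less_one)
        obtain d2 where d2: "d2 > 0" "\<And>\<tau>. dist \<tau> s < d2 \<Longrightarrow> dist (v \<tau>) (v s) < 1"
          using cv[OF s] unfolding continuous_at_eps_delta by (metis zero_less_one)
        obtain d3 where d3: "d3 > 0" "ball s d3 \<subseteq> ?A"
          using \<open>open ?A\<close> s openE by blast
        define d where "d = min d3 (min d1 d2)"
        have "d > 0" using d1 d2 d3 by (simp add: d_def)
        have "u t = v t" if t: "dist t s < d" for t
        proof -
          have seg: "dist \<tau> s < d" if "\<tau> \<in> closed_segment t s" for \<tau>
            using that t by (auto simp: closed_segment_eq_real_ivl dist_real_def split: if_splits)
          have "(u has_vector_derivative f (u \<tau>)) (at \<tau>) \<and> u \<tau> \<in> cball (u s) 1"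
            "(v has_vector_derivative f (v \<tau>)) (at \<tau>) \<and> v \<tau> \<in> cball (u s) 1"
            if "\<tau> \<in> closed_segment t s" for \<tau>
          proof -
            have \<tau>: "dist \<tau> s < d1" "dist \<tau> s < d2" "\<tau> \<in> ?A"
              using seg[OF that] d3(2) by (auto simp: d_def dist_commute)
            then show "(u has_vector_derivative f (u \<tau>)) (at \<tau>) \<and> u \<tau> \<in> cball (u s) 1"
              "(v has_vector_derivative f (v \<tau>)) (at \<tau>) \<and> v \<tau> \<in> cball (u s) 1"
              using u v d1(2)[of \<tau>] d2(2)[of \<tau>] True
              by (auto simp: solves_ivp_def dist_commute)
          qed
          from lipschitz_trajectories_dist[where s = t and t = s, OF K this] show ?thesis using True by simp
        qed
        then show ?thesis using True \<open>d > 0\<close> unfolding eventually_at by auto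
      next
        case False
        have "isCont (\<lambda>t. u t - v t) s" using cu[OF s] cv[OF s] by (rule continuous_diff)
        then have "((\<lambda>t. u t - v t) \<longlongrightarrow> u s - v s) (at s within ?A)"
          unfolding isCont_def by (rule tendsto_within_subset) simp
        then have "eventually (\<lambda>t. u t - v t \<noteq> 0) (at s within ?A)"
          by (rule tendsto_imp_eventually_ne) (use False in simp)
        then show ?thesis by eventually_elim (use False in auto)
      qed
    qed
  qed (use \<open>0 \<in> ?A\<close> assms in auto)
  then show ?thesis using u v by (auto simp: solves_ivp_def)
qed

lemma flow_eq_solution:
  fixes f :: "'a::euclidean_space \<Rightarrow> 'a"
  assumes "Cq 1 f" "solves_ivp f x I u" "t \<in> I"
  shows "flow f t x = u t"
  unfolding flow_def using assms solution_unique[OF assms(1)] by (intro the_equality) blast+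

lemma conserved_along_solution:
  fixes f :: "'a::euclidean_space \<Rightarrow> 'a"
  assumes "Cq 1 f" "conserved_quantity f F" "solves_ivp f x I u" "t \<in> I"
  shows "F (u t) = F x"
  using assms flow_eq_solution[OF assms(1,3,4)]
  unfolding conserved_quantity_def flow_dom_def by fastforce

text \<open>
The Picard-Lindeloef theorem, with a time of existence that is uniform for the initial values near
\<open>p\<close>. Replacing \<open>f\<close> by its composition with the projection onto the unit ball around \<open>p\<close> gives a
field \<open>g\<close> that is bounded and globally Lipschitz, so that the Picard operator \<open>P\<close> is a contraction of
the whole space of bounded continuous functions. A short time keeps its fixed point inside the
ball, where \<open>g\<close> is \<open>f\<close>.
\<close>

lemma local_solutions_exist:
  fixes f :: "'a::euclidean_space \<Rightarrow> 'a"
  assumes "Cq 1 f"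
  obtains d where "d > 0"
    "\<And>y. dist y p \<le> 1/2 \<Longrightarrow> \<exists>w. solves_ivp f y {-d<..<d} w \<and> (\<forall>t\<in>{-d<..<d}. w t \<in> cball p 1)"
proof -
  let ?B = "cball p (1::real)"
  define g where "g = f \<circ> closest_point ?B"
  have proj: "closest_point ?B x \<in> ?B" for x by (rule closest_point_in_set) auto
  obtain K where K: "K \<ge> 0" "\<And>x y. x \<in> ?B \<Longrightarrow> y \<in> ?B \<Longrightarrow> dist (f x) (f y) \<le> K * dist x y"
    using C1_lipschitz_on_cball[OF assms] by metis
  have lip: "dist (g x) (g y) \<le> K * dist x y" for x y
  proof -
    have "dist (g x) (g y) \<le> K * dist (closest_point ?B x) (closest_point ?B y)"
      unfolding g_def comp_def by (intro K proj)
    also have "\<dots> \<le> K * dist x y" using K(1) by (intro mult_left_mono closest_point_lipschitz) auto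
    finally show ?thesis .
  qed
  have cg: "continuous_on UNIV g"
    using lip K(1) by (intro lipschitz_on_continuous_on[of K] lipschitz_onI) auto
  define M where "M = norm (f p) + K"
  have M: "norm (g x) \<le> M" for x
  proof -
    have "dist (g x) (f p) \<le> K * dist (closest_point ?B x) p"
      unfolding g_def comp_def by (intro K proj) auto
    also have "\<dots> \<le> K * 1" using proj[of x] K(1) by (intro mult_left_mono) (auto simp: dist_commute)
    finally show ?thesis using norm_triangle_sub[of "g x" "f p"] by (simp add: M_def dist_norm)
  qed
  have "M \<ge> 0" using M[of p] norm_ge_zero order_trans by blast
  \<comment> \<open>The two integrals in the Picard operator run over at most \<open>2 * d\<close> each. This \<open>d\<close> therefore makes
    the contraction factor, and also the distance travelled, at most \<open>1/2\<close>.\<close>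
  define d where "d = 1 / (8 * (K + M + 1))"
  have d: "d > 0" "8 * (K * d) \<le> 1" "8 * (M * d) \<le> 1"
    using K(1) \<open>M \<ge> 0\<close> by (auto simp: d_def field_simps)
  have cgu: "continuous_on X (\<lambda>s. g (apply_bcontfun u s))" for X u
    using continuous_on_compose2[OF cg, of X "apply_bcontfun u"] by auto
  have "\<exists>w. solves_ivp f y {-d<..<d} w \<and> (\<forall>t\<in>{-d<..<d}. w t \<in> ?B)" if y: "dist y p \<le> 1/2" for y
  proof -
    \<comment> \<open>Clamping the time to \<open>{-d..d}\<close> gives functions that are defined and bounded on the whole line.\<close>
    define cl where "cl t = min d (max (- d) t)" for t :: real
    have cl: "cl t \<in> {-d..d}" for t using d(1) by (auto simp: cl_def)
    \<comment> \<open>The integral from \<open>0\<close> to \<open>cl t\<close> for times of either sign, as a difference of two integrals from \<open>-d\<close>.\<close>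
    define P where "P u t = y + integral {-d..cl t} (\<lambda>s. g (apply_bcontfun u s))
        - integral {-d..0} (\<lambda>s. g (apply_bcontfun u s))" for u :: "real \<Rightarrow>\<^sub>C 'a" and t
    have bound: "norm (integral {-d..a} h - integral {-d..0} h) \<le> 4 * (N * d)"
      if h: "continuous_on UNIV h" "\<And>s. norm (h s) \<le> N" and a: "a \<in> {-d..d}" for h :: "real \<Rightarrow> 'a" and N a
    proof -
      have "N \<ge> 0" using h(2)[of 0] norm_ge_zero order_trans by blast
      have *: "norm (integral {-d..b} h) \<le> N * (2 * d)" if "b \<in> {-d..d}" for b
      proof -
        have "norm (integral {-d..b} h) \<le> N * (b - (-d))"
          using that h by (intro integral_bound) (auto intro: continuous_on_subset)
        also have "\<dots> \<le> N * (2 * d)" using that \<open>N \<ge> 0\<close> by (intro mult_left_mono) auto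
        finally show ?thesis .
      qed
      show ?thesis
        using *[OF a] *[of 0] d(1) norm_triangle_ineq4[of "integral {-d..a} h" "integral {-d..0} h"]
        by simp
    qed
    have P_near: "dist (P u t) y \<le> 1/2" for u t
      using bound[OF cgu[of UNIV u] M cl[of t]] d(3) by (simp add: P_def dist_norm)
    have P_cont: "continuous_on UNIV (P u)" for u
    proof -
      have "continuous_on {-d..d} (\<lambda>t. integral {-d..t} (\<lambda>s. g (apply_bcontfun u s)))"
        by (intro indefinite_integral_continuous_1 integrable_continuous_real cgu)
      then have "continuous_on UNIV (\<lambda>t. integral {-d..cl t} (\<lambda>s. g (apply_bcontfun u s)))"
        by (rule continuous_on_compose2) (use cl in \<open>auto simp: cl_def intro!: continuous_intros\<close>)
      then show ?thesis unfolding P_def by (intro continuous_intros)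
    qed
    have P_bcontfun: "P u \<in> bcontfun" for u
    proof (rule bcontfun_normI[OF P_cont])
      show "norm (P u t) \<le> norm y + 1/2" for t
        using P_near[of u t] norm_triangle_sub[of "P u t" y] by (simp add: dist_norm)
    qed
    have "\<exists>!u. Bcontfun (P u) = u"
    proof (rule banach_fix_type)
      show "\<forall>u v. dist (Bcontfun (P u)) (Bcontfun (P v)) \<le> 1/2 * dist u v"
      proof (intro allI dist_bound)
        fix u v :: "real \<Rightarrow>\<^sub>C 'a" and t
        let ?h = "\<lambda>s. g (apply_bcontfun u s) - g (apply_bcontfun v s)"
        have int: "(\<lambda>s. g (apply_bcontfun w s)) integrable_on {-d..a}" for w a
          by (intro integrable_continuous_real cgu)
        have "P u t - P v t = integral {-d..cl t} ?h - integral {-d..0} ?h"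
          unfolding P_def by (subst (1 2) integral_diff) (auto intro: int)
        moreover have h: "norm (?h s) \<le> K * dist u v" for s
        proof -
          have "norm (?h s) \<le> K * dist (apply_bcontfun u s) (apply_bcontfun v s)"
            using lip by (simp add: dist_norm)
          also have "\<dots> \<le> K * dist u v" using K(1) by (intro mult_left_mono dist_bounded)
          finally show ?thesis .
        qed
        ultimately have "dist (P u t) (P v t) \<le> 4 * (K * dist u v * d)"
          using bound[OF continuous_on_diff[OF cgu cgu] h cl[of t]] by (simp add: dist_norm)
        also have "\<dots> = 8 * (K * d) * (1/2 * dist u v)" by simp
        also have "\<dots> \<le> 1 * (1/2 * dist u v)" using d(2) by (intro mult_right_mono) auto
        finally show "dist (apply_bcontfun (Bcontfun (P u)) t) (apply_bcontfun (Bcontfun (P v)) t)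
            \<le> 1/2 * dist u v"
          by (simp add: Bcontfun_inverse P_bcontfun)
      qed
    qed auto
    then obtain u where "Bcontfun (P u) = u" by blast
    then have u: "apply_bcontfun u t = P u t" for t using Bcontfun_inverse[OF P_bcontfun] by metis
    have in_B: "apply_bcontfun u t \<in> ?B" for t
      using P_near[of u t] y dist_triangle[of "P u t" p y] by (simp add: u dist_commute)
    have "solves_ivp f y {-d<..<d} (apply_bcontfun u)" unfolding solves_ivp_def
    proof (intro conjI ballI)
      show "apply_bcontfun u 0 = y" using d(1) unfolding u[of 0] by (simp add: P_def cl_def)
      fix t assume t: "t \<in> {-d<..<d}"
      have "((\<lambda>t. integral {-d..t} (\<lambda>s. g (apply_bcontfun u s))) has_vector_derivative
          g (apply_bcontfun u t)) (at t within {-d..d})"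
        using t by (intro integral_has_vector_derivative cgu) auto
      then have "((\<lambda>t. integral {-d..t} (\<lambda>s. g (apply_bcontfun u s))) has_vector_derivative
          g (apply_bcontfun u t)) (at t within {-d<..<d})"
        by (rule has_vector_derivative_within_subset) auto
      then have "((\<lambda>t. integral {-d..t} (\<lambda>s. g (apply_bcontfun u s))) has_vector_derivative
          g (apply_bcontfun u t)) (at t)"
        using at_within_open[OF t open_greaterThanLessThan] by simp
      from has_vector_derivative_diff[OF has_vector_derivative_add[OF has_vector_derivative_const this]
          has_vector_derivative_const]
      have deriv: "((\<lambda>t. y + integral {-d..t} (\<lambda>s. g (apply_bcontfun u s))
          - integral {-d..0} (\<lambda>s. g (apply_bcontfun u s))) has_vector_derivative
          g (apply_bcontfun u t)) (at t)"
        by simp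
      have eq: "y + integral {-d..s} (\<lambda>s. g (apply_bcontfun u s))
          - integral {-d..0} (\<lambda>s. g (apply_bcontfun u s)) = apply_bcontfun u s" if "s \<in> {-d<..<d}" for s
        unfolding u[of s] using that by (simp add: P_def cl_def)
      have "(apply_bcontfun u has_vector_derivative g (apply_bcontfun u t)) (at t)"
        by (rule has_vector_derivative_transform_within_open[OF deriv open_greaterThanLessThan t eq])
      moreover have "g (apply_bcontfun u t) = f (apply_bcontfun u t)"
        using in_B by (simp add: g_def closest_point_self)
      ultimately show "(apply_bcontfun u has_vector_derivative f (apply_bcontfun u t)) (at t)" by simp
    qed (use d(1) in \<open>auto simp: is_interval_oo\<close>)
    with in_B show ?thesis by blast
  qed
  with d(1) show thesis using that by blast
qed

section \<open>Transport of flatness along trajectories\<close>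

text \<open>
Near a time \<open>t0\<close>, the flow is defined on a neighbourhood of the trajectory and is Lipschitz: from any
\<open>y\<close> close to \<open>u t\<close> one can follow the solution through \<open>y\<close> for the time \<open>s - t\<close>, and it ends at a point
\<open>z\<close> close to \<open>u s\<close>, with the same value of the conserved quantity.
\<close>

lemma solution_near_trajectory:
  fixes f :: "'a::euclidean_space \<Rightarrow> 'a"
  assumes "Cq 1 f" "conserved_quantity f F" and u: "solves_ivp f x I u" and "t0 \<in> I"
  obtains h C where "h > 0" "ball t0 h \<subseteq> I"
    "\<And>s t y. s \<in> ball t0 h \<Longrightarrow> t \<in> ball t0 h \<Longrightarrow> dist y (u t) < 1/4 \<Longrightarrow>
       \<exists>z. dist z (u s) \<le> C * dist y (u t) \<and> F z = F y"
proof -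
  define p where "p = u t0"
  obtain K where K: "K \<ge> 0" "\<And>x y. x \<in> cball p 1 \<Longrightarrow> y \<in> cball p 1 \<Longrightarrow> dist (f x) (f y) \<le> K * dist x y"
    using C1_lipschitz_on_cball[OF assms(1)] by metis
  obtain d where d: "d > 0"
    "\<And>y. dist y p \<le> 1/2 \<Longrightarrow> \<exists>w. solves_ivp f y {-d<..<d} w \<and> (\<forall>t\<in>{-d<..<d}. w t \<in> cball p 1)"
    using local_solutions_exist[OF assms(1)] by metis
  have ou: "open I" and du: "\<And>t. t \<in> I \<Longrightarrow> (u has_vector_derivative f (u t)) (at t)"
    using u by (auto simp: solves_ivp_def)
  obtain d1 where d1: "d1 > 0" "ball t0 d1 \<subseteq> I" using ou \<open>t0 \<in> I\<close> openE by blast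
  have "isCont u t0" using du[OF \<open>t0 \<in> I\<close>] by (rule has_vector_derivative_continuous)
  then obtain d2 where d2: "d2 > 0" "\<And>t. dist t t0 < d2 \<Longrightarrow> dist (u t) p < 1/4"
    unfolding continuous_at_eps_delta p_def by (metis zero_less_divide_1_iff zero_less_numeral)
  define h where "h = min (d / 2) (min d1 d2)"
  have h: "h > 0" using d d1 d2 by (simp add: h_def)
  have hI: "ball t0 h \<subseteq> I" using d1(2) by (auto simp: h_def)
  show thesis
  proof (rule that[OF h hI, of "exp (K * d)"])
    fix s t y assume st: "s \<in> ball t0 h" "t \<in> ball t0 h" and y: "dist y (u t) < 1/4"
    have near: "dist (u \<tau>) p < 1/4" if "\<tau> \<in> ball t0 h" for \<tau>
      using that by (intro d2) (simp add: h_def dist_commute)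
    have "dist y p \<le> 1/2" using near[OF st(2)] y dist_triangle[of y p "u t"] by simp
    then obtain w where w: "solves_ivp f y {-d<..<d} w" "\<And>\<tau>. \<tau> \<in> {-d<..<d} \<Longrightarrow> w \<tau> \<in> cball p 1"
      using d(2) by blast
    have st_d: "\<bar>s - t\<bar> < d" using st by (simp add: h_def dist_real_def abs_if split: if_splits)
    have "dist (w (s - t)) (u (t + (s - t))) \<le> exp (K * \<bar>(s - t) - 0\<bar>) * dist (w 0) (u (t + 0))"
    proof (rule lipschitz_trajectories_dist[OF K(2)])
      fix \<tau> assume \<tau>: "\<tau> \<in> closed_segment (s - t) 0"
      then have "\<tau> \<in> {-d<..<d}" using st_d by (auto simp: closed_segment_eq_real_ivl split: if_splits)
      then show "(w has_vector_derivative f (w \<tau>)) (at \<tau>) \<and> w \<tau> \<in> cball p 1"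
        using w by (auto simp: solves_ivp_def)
      have t\<tau>: "t + \<tau> \<in> ball t0 h"
        using \<tau> st by (auto simp: closed_segment_eq_real_ivl dist_real_def split: if_splits)
      then have "(u has_vector_derivative f (u (t + \<tau>))) (at (t + \<tau>))" using hI by (intro du) auto
      moreover have "((\<lambda>\<tau>. t + \<tau>) has_vector_derivative 1) (at \<tau>)"
        by (auto intro!: derivative_eq_intros)
      ultimately have "((\<lambda>\<tau>. u (t + \<tau>)) has_vector_derivative f (u (t + \<tau>))) (at \<tau>)"
        using vector_diff_chain_at[of "\<lambda>\<tau>. t + \<tau>" 1 \<tau> u] by (simp add: comp_def)
      moreover have "u (t + \<tau>) \<in> cball p 1" using near[OF t\<tau>] by (simp add: dist_commute)
      ultimately show "((\<lambda>\<tau>. u (t + \<tau>)) has_vector_derivative f (u (t + \<tau>))) (at \<tau>)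
          \<and> u (t + \<tau>) \<in> cball p 1" ..
    qed
    also have "w 0 = y" using w(1) by (simp add: solves_ivp_def)
    finally have "dist (w (s - t)) (u s) \<le> exp (K * \<bar>s - t\<bar>) * dist y (u t)" by simp
    also have "\<dots> \<le> exp (K * d) * dist y (u t)"
      using st_d K(1) by (intro mult_right_mono) (auto intro: mult_left_mono)
    finally have "dist (w (s - t)) (u s) \<le> exp (K * d) * dist y (u t)" .
    moreover have "F (w (s - t)) = F y"
      using st_d by (intro conserved_along_solution[OF assms(1,2) w(1)]) (auto simp: abs_less_iff)
    ultimately show "\<exists>z. dist z (u s) \<le> exp (K * d) * dist y (u t) \<and> F z = F y" by blast
  qed
qed

text \<open>
Two times near \<open>t0\<close> can exchange their roles in the preceding lemma, so flatness of \<open>F\<close> at \<open>u t\<close> is a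
locally constant property of \<open>t\<close>, hence constant on the interval \<open>I\<close>.
\<close>

lemma flat_at_along_solution:
  fixes f :: "'a::euclidean_space \<Rightarrow> 'a" and F :: "'a \<Rightarrow> 'b::metric_space"
  assumes "Cq 1 f" "conserved_quantity f F" and u: "solves_ivp f x I u" and "t \<in> I"
    and "flat_at r F x"
  shows "flat_at r F (u t)"
proof -
  have "flat_at r F (u 0) = flat_at r F (u t)"
  proof (rule connected_local_const[of I])
    show "connected I" "0 \<in> I" using u by (auto simp: solves_ivp_def is_interval_connected)
    show "t \<in> I" by fact
    show "\<forall>t0\<in>I. eventually (\<lambda>t. flat_at r F (u t0) = flat_at r F (u t)) (at t0 within I)"
    proof
      fix t0 assume "t0 \<in> I"
      obtain h C where h: "h > 0" "ball t0 h \<subseteq> I"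
        and z: "\<And>s t y. s \<in> ball t0 h \<Longrightarrow> t \<in> ball t0 h \<Longrightarrow> dist y (u t) < 1/4 \<Longrightarrow>
          \<exists>z. dist z (u s) \<le> C * dist y (u t) \<and> F z = F y"
        using solution_near_trajectory[OF assms(1,2) u \<open>t0 \<in> I\<close>] by metis
      have *: "flat_at r F (u t)" if "s \<in> ball t0 h" "t \<in> ball t0 h" "flat_at r F (u s)" for s t
      proof (rule flat_at_transport[OF that(3), where d = "1/4"])
        show "F (u t) = F (u s)"
          using that h(2) conserved_along_solution[OF assms(1,2) u] by (metis subsetD)
      qed (use z[OF that(1,2)] in auto)
      have "flat_at r F (u t0) = flat_at r F (u t)" if "dist t t0 < h" for t
        using *[of t t0] *[of t0 t] that h(1) by (auto simp: dist_commute)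
      then show "eventually (\<lambda>t. flat_at r F (u t0) = flat_at r F (u t)) (at t0 within I)"
        unfolding eventually_at using h(1) by blast
    qed
  qed
  with u assms(5) show ?thesis by (simp add: solves_ivp_def)
qed

theorem theorem2p5:
  fixes f :: "real^'n \<Rightarrow> real^'n" and F :: "real^'n \<Rightarrow> real^'k" and q :: nat
  assumes "q \<ge> 1"
    and "Cq q f"
    and "CARD('k) \<le> CARD('n)"
    and "Cq q F"
    and "conserved_quantity f F"
  shows "\<forall>r\<in>{1..q}. invariant_set f (N_set F r)"
proof
  fix r assume r: "r \<in> {1..q}"
  have f: "Cq 1 f" using assms(2,1) by (rule Cq_mono)
  have F: "Cq r F" using assms(4) r by (auto intro: Cq_mono)
  show "invariant_set f (N_set F r)" unfolding invariant_set_def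
  proof (intro ballI)
    fix x t assume x: "x \<in> N_set F r" and "t \<in> flow_dom f x"
    then obtain I u where u: "solves_ivp f x I u" "t \<in> I" by (auto simp: flow_dom_def)
    have "flat_at r (\<lambda>y. F y $ i) (u t)" for i
    proof (rule flat_at_along_solution[OF f _ u])
      show "conserved_quantity f (\<lambda>y. F y $ i)" using assms(5) by (simp add: conserved_quantity_def)
      show "flat_at r (\<lambda>y. F y $ i) x" using x by (simp add: mem_N_set_iff_flat_at[OF F])
    qed
    then show "flow f t x \<in> N_set F r"
      by (simp add: mem_N_set_iff_flat_at[OF F] flow_eq_solution[OF f u])
  qed
qed

end
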